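(* Let $T\in\mathscr L(M,V')$, $f\in V'$ with $f\ne0$, and let $\mu\in E$ be a solution of $T\mu=f$ which satisfies $\varepsilon^{\mathrm{int}}_h(\mu)\leq1/2$. Fix $r>0$ such that $\|\mu\|_E\leq r\|\mu\|_M$. Let $z_h\in M_h$ be a solution of $$\|T_hz_h\|_{V_h'}=\alpha(T_h)\quad\text{with}\quad\|z_h\|_M=1,$$ and let $\mu_h\in M_h$ be a solution of $$\mu_h=\operatorname*{arg\,min}_{m\in M_h,\ m\perp z_h}\|T_hm-f_h\|_{V_h'},\quad\text{with }\mu_h\perp z_h.$$ If $\beta(T_h)>0$, then there exists $t\in\mathbb R$ such that $\mu_{h,t}:=tz_h+\mu_h$ satisfies $$\frac{\|\mu_{h,t}-\pi_h\mu\|_M}{\|\pi_h\mu\|_M}\leq\frac{4}{\beta(T_h)}\left[r\,\varepsilon^{\mathrm{op}}_h+\rho(T)\left(\varepsilon^{\mathrm{rhs}}_h+\varepsilon^{\mathrm{int}}_h(\mu)\right)+\frac{\alpha(T_h)}{2}\right].$$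
   Context: Setting. $M$ and $V$ are real Hilbert spaces; $E\subset M$ is a Banach space (with its own norm $\|\cdot\|_E$) that is dense in $M$; $V'$ is the dual of $V$ (bounded linear forms) with the operator norm; $\mathscr L(M,V')$ is the space of bounded linear operators. Discretization. $(M_h)_{h>0}$ and $(V_h)_{h>0}$ are families of finite-dimensional subspaces of $M$ and $V$ that approach $M$ and $V$ respectively: a family $(X_h)_{h>0}$ of subspaces of $X$ approaches $X$ if for every $x\in X$ there are $x_h\in X_h$ with $\|x_h-x\|_X\to0$ as $h\to0$. $M_h$, $V_h$ carry the norms of $M$, $V$. One has $M_h\subset E$, and $E_h$ denotes $M_h$ endowed with the $E$-norm. $\pi_h:M\to M_h$ is the orthogonal projection, and it is assumed that $\|\pi_h m\|_E\le\|m\|_E$ for all $m\in E$. For nonzero $\mu\in M$, $\varepsilon^{\mathrm{int}}_h(\mu):=\|\pi_h\mu-\mu\|_M/\|\mu\|_M$. $V_h'$ is the space of linear forms on $V_h$ with norm $\|g\|_{V_h'}=\sup_{v\in V_h}\langle g,v\rangle/\|v\|_V$; elements of $V'$ are regarded as elements of $V_h'$ by restriction. For each $h>0$, an operator $T_h\in\mathscr L(M_h,V_h')$ and an element $f_h\in V_h'$ are given, and $$\varepsilon^{\mathrm{op}}_h:=\sup_{\mu\in E_h}\sup_{v\in V_h}\frac{\langle (T_h-T)\mu,v\rangle_{V_h',V_h}}{\|\mu\|_E\|v\|_V},\qquad \varepsilon^{\mathrm{rhs}}_h:=\frac1{\|f\|_{V'}}\sup_{v\in V_h}\frac{\langle f_h-f,v\rangle_{V_h',V_h}}{\|v\|_V}.$$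 Constants. All infima and suprema of quotients are over nonzero vectors (infimum over the empty set is $+\infty$). For $T\in\mathscr L(M,V')$, $$\alpha(T):=\inf_{\mu\in M}\sup_{v\in V}\frac{\langle T\mu,v\rangle_{V',V}}{\|\mu\|_M\|v\|_V},\qquad \rho(T):=\sup_{\mu\in M}\sup_{v\in V}\frac{\langle T\mu,v\rangle_{V',V}}{\|\mu\|_M\|v\|_V},$$ $$\beta_e(T):=\inf_{\mu\in M,\ \mu\perp e}\ \sup_{v\in V}\frac{\langle T\mu,v\rangle_{V',V}}{\|\mu\|_M\|v\|_V}\ (e\in M,\ e\ne0),\qquad \beta(T):=\sup_{e\in M,\ \|e\|_M=1}\beta_e(T).$$ $\alpha(T_h)$ and $\beta(T_h)$ are defined by the same formulas with $(T,M,V)$ replaced by $(T_h,M_h,V_h)$; $\perp$ denotes orthogonality in $M$. *)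

theory Defs
  imports "HOL-Analysis.Analysis"
begin

text \<open>
  A Banach space contained in an ambient vector space, with a norm of its own. The values of
  \<open>nE\<close> outside \<open>E\<close> are irrelevant, and no continuity of the inclusion is required.
\<close>

definition banach_space_on :: "'a::real_vector set \<Rightarrow> ('a \<Rightarrow> real) \<Rightarrow> bool" where
  "banach_space_on E nE \<longleftrightarrow>
     subspace E \<and>
     (\<forall>x\<in>E. 0 \<le> nE x \<and> (nE x = 0 \<longleftrightarrow> x = 0)) \<and>
     (\<forall>x\<in>E. \<forall>c. nE (c *\<^sub>R x) = \<bar>c\<bar> * nE x) \<and>
     (\<forall>x\<in>E. \<forall>y\<in>E. nE (x + y) \<le> nE x + nE y) \<and>
     (\<forall>\<sigma>. (\<forall>n. \<sigma> n \<in> E) \<and> (\<forall>e>0. \<exists>N::nat. \<forall>m\<ge>N. \<forall>n\<ge>N. nE (\<sigma> m - \<sigma> n) < e)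
          \<longrightarrow> (\<exists>x\<in>E. (\<lambda>n. nE (\<sigma> n - x)) \<longlonglongrightarrow> 0))"

definition finite_dim_subspace :: "'a::real_vector set \<Rightarrow> bool" where
  "finite_dim_subspace X \<longleftrightarrow> subspace X \<and> (\<exists>B. finite B \<and> span B = X)"

definition approaches_space :: "(real \<Rightarrow> 'a::real_normed_vector set) \<Rightarrow> bool" where
  "approaches_space X \<longleftrightarrow>
     (\<forall>x. \<exists>xh. (\<forall>h>0. xh h \<in> X h) \<and> ((\<lambda>h. norm (xh h - x)) \<longlongrightarrow> 0) (at_right 0))"

definition orth_proj :: "'a::real_inner set \<Rightarrow> 'a \<Rightarrow> 'a" where
  "orth_proj X x = (THE p. p \<in> X \<and> (\<forall>y\<in>X. orthogonal (x - p) y))"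

text \<open>
  Elements of the dual of a subspace \<open>W\<close>, and operators from a subspace \<open>X\<close> to the dual of \<open>W\<close>,
  are represented by total functions of which only the values on \<open>W\<close>, respectively on
  \<open>X \<times> W\<close>, matter. Restricting a functional to \<open>W\<close> then does not change the function.
\<close>

definition linear_form_on :: "'b::real_vector set \<Rightarrow> ('b \<Rightarrow> real) \<Rightarrow> bool" where
  "linear_form_on W g \<longleftrightarrow>
     (\<forall>v\<in>W. \<forall>w\<in>W. g (v + w) = g v + g w) \<and> (\<forall>v\<in>W. \<forall>c. g (c *\<^sub>R v) = c * g v)"

definition bounded_operator_on ::
    "'a::real_normed_vector set \<Rightarrow> 'b::real_normed_vector set \<Rightarrow> ('a \<Rightarrow> 'b \<Rightarrow> real) \<Rightarrow> bool" where
  "bounded_operator_on X W A \<longleftrightarrow>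
     (\<forall>m\<in>X. linear_form_on W (A m)) \<and>
     (\<forall>m\<in>X. \<forall>n\<in>X. \<forall>v\<in>W. A (m + n) v = A m v + A n v) \<and>
     (\<forall>m\<in>X. \<forall>c. \<forall>v\<in>W. A (c *\<^sub>R m) v = c * A m v) \<and>
     (\<exists>K. \<forall>m\<in>X. \<forall>v\<in>W. \<bar>A m v\<bar> \<le> K * norm m * norm v)"

text \<open>
  Infima and suprema of quotients are taken in \<open>[0,\<infinity>]\<close>, so that the infimum of the empty set
  is \<open>\<infinity>\<close> and the supremum of the empty set is \<open>0\<close> (the norm of the only functional on the
  zero space). The map \<open>ennreal\<close> sends negative quotients to \<open>0\<close>; this does not affect a
  supremum over the nonzero vectors \<open>v\<close> of a subspace, because replacing \<open>v\<close> by \<open>- v\<close> changes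
  the sign of the quotient.
\<close>

definition dual_norm :: "'b::real_normed_vector set \<Rightarrow> ('b \<Rightarrow> real) \<Rightarrow> ennreal" where
  "dual_norm W g = (SUP v\<in>W - {0}. ennreal (g v / norm v))"

definition alpha_const ::
    "'a::real_normed_vector set \<Rightarrow> 'b::real_normed_vector set \<Rightarrow> ('a \<Rightarrow> 'b \<Rightarrow> real) \<Rightarrow> ennreal" where
  "alpha_const X W A =
     (INF m\<in>X - {0}. SUP v\<in>W - {0}. ennreal (A m v / (norm m * norm v)))"

definition rho_const ::
    "'a::real_normed_vector set \<Rightarrow> 'b::real_normed_vector set \<Rightarrow> ('a \<Rightarrow> 'b \<Rightarrow> real) \<Rightarrow> ennreal" where
  "rho_const X W A =
     (SUP m\<in>X - {0}. SUP v\<in>W - {0}. ennreal (A m v / (norm m * norm v)))"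

definition beta_at ::
    "'a::real_inner set \<Rightarrow> 'b::real_normed_vector set \<Rightarrow> ('a \<Rightarrow> 'b \<Rightarrow> real) \<Rightarrow> 'a \<Rightarrow> ennreal" where
  "beta_at X W A e =
     (INF m\<in>{m \<in> X - {0}. orthogonal m e}.
        SUP v\<in>W - {0}. ennreal (A m v / (norm m * norm v)))"

definition beta_const ::
    "'a::real_inner set \<Rightarrow> 'b::real_normed_vector set \<Rightarrow> ('a \<Rightarrow> 'b \<Rightarrow> real) \<Rightarrow> ennreal" where
  "beta_const X W A = (SUP e\<in>{e \<in> X. norm e = 1}. beta_at X W A e)"

definition eps_int :: "'a::real_inner set \<Rightarrow> 'a \<Rightarrow> real" where
  "eps_int X m = norm (orth_proj X m - m) / norm m"

definition eps_op ::
    "('a::real_normed_vector \<Rightarrow> real) \<Rightarrow> 'a set \<Rightarrow> 'b::real_normed_vector set \<Rightarrow>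
     ('a \<Rightarrow> 'b \<Rightarrow> real) \<Rightarrow> ('a \<Rightarrow>\<^sub>L ('b \<Rightarrow>\<^sub>L real)) \<Rightarrow> ennreal" where
  "eps_op nE X W A T =
     (SUP m\<in>X - {0}. SUP v\<in>W - {0}. ennreal ((A m v - T m v) / (nE m * norm v)))"

definition eps_rhs ::
    "'b::real_normed_vector set \<Rightarrow> ('b \<Rightarrow> real) \<Rightarrow> ('b \<Rightarrow>\<^sub>L real) \<Rightarrow> ennreal" where
  "eps_rhs W g f = ennreal (1 / norm f) * (SUP v\<in>W - {0}. ennreal ((g v - f v) / norm v))"

end

theory Submission
  imports Defs
begin

text \<open>
  Since \<open>V\<^sub>h'\<close> is a Hilbert space, \<open>\<alpha>(T\<^sub>h)\<close> and \<open>\<beta>(T\<^sub>h)\<close> are the two smallest singular values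
  of \<open>T\<^sub>h\<close>, and \<open>z\<close> is a singular vector for the smallest one. Hence \<open>T\<^sub>h z\<close> and \<open>T\<^sub>h d\<close> are
  orthogonal for every \<open>d \<perp> z\<close>, and, as in the Courant--Fischer principle,
  \<open>\<beta>(T\<^sub>h) \<parallel>d\<parallel> \<le> \<parallel>T\<^sub>h d\<parallel>\<close>. Write \<open>\<pi>\<^sub>h \<mu> = t z + q\<close> with \<open>q \<perp> z\<close> and take \<open>d = \<mu>\<^sub>h - q\<close>. The
  minimality of \<open>\<mu>\<^sub>h\<close> gives \<open>\<parallel>T\<^sub>h d\<parallel> \<le> 2 \<parallel>T\<^sub>h q - f\<^sub>h\<parallel> \<le> 2 \<parallel>T\<^sub>h \<pi>\<^sub>h \<mu> - f\<^sub>h\<parallel> + 2 \<bar>t\<bar> \<alpha>(T\<^sub>h)\<close>,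
  and the first term is a consistency error.
\<close>

section \<open>Riesz representation and orthogonal projection in finite dimension\<close>

text \<open>In an orthogonal spanning set the representer is the explicit expansion with
  coefficients \<open>g c / (c \<bullet> c)\<close>. Representers turn dual norms into Hilbert norms
  and give a meaning to orthogonality of functionals.\<close>

lemma linear_form_on_representation:
  fixes W :: "'a::real_inner set"
  assumes "finite_dim_subspace W" "linear_form_on W g"
  obtains w where "w \<in> W" "\<And>v. v \<in> W \<Longrightarrow> g v = w \<bullet> v"
proof -
  obtain B where "finite B" "span B = W"
    using assms(1) by (auto simp: finite_dim_subspace_def)
  with basis_orthogonal obtain C where C: "finite C" "span C = W" "pairwise orthogonal C"
    by metis
  define w where "w = (\<Sum>c\<in>C. (g c / (c \<bullet> c)) *\<^sub>R c)"
  have sub: "subspace W" using assms(1) by (simp add: finite_dim_subspace_def)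
  have g_scale: "g (c *\<^sub>R v) = c * g v" if "v \<in> W" for c v
    using assms(2) that by (simp add: linear_form_on_def)
  have g0: "g 0 = 0" using g_scale[of 0 0] subspace_0[OF sub] by simp
  have w: "w \<in> W"
    unfolding w_def C(2)[symmetric] by (intro span_sum span_scale span_base)
  have base: "g c = w \<bullet> c" if c: "c \<in> C" for c
  proof -
    have "w \<bullet> c = (\<Sum>b\<in>C. (g b / (b \<bullet> b)) * (b \<bullet> c))"
      by (simp add: w_def inner_sum_left)
    also have "\<dots> = (\<Sum>b\<in>C. if b = c then (g c / (c \<bullet> c)) * (c \<bullet> c) else 0)"
      using C(3) c by (intro sum.cong) (auto simp: pairwise_def orthogonal_def)
    \<comment> \<open>The orthogonal set may contain 0. Its coefficient is then 0 by the convention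
      \<open>x / 0 = 0\<close>, in agreement with \<open>g 0 = 0\<close>.\<close>
    also have "\<dots> = g c" using C(1) c g0 by (cases "c = 0") simp_all
    finally show ?thesis by simp
  qed
  have "v \<in> W \<and> g v = w \<bullet> v" if "v \<in> span C" for v
    using that
  proof (induction rule: span_induct_alt)
    case base
    then show ?case using sub by (simp add: g0 subspace_0)
  next
    case (step c x y)
    have mem: "x \<in> W" "c *\<^sub>R x \<in> W" "y \<in> W"
      using step C(2) sub by (auto intro: span_base subspace_scale)
    have "g (c *\<^sub>R x + y) = g (c *\<^sub>R x) + g y"
      using assms(2) mem by (simp add: linear_form_on_def)
    then show ?case
      using step base mem sub by (simp add: g_scale inner_add_right subspace_add)
  qed
  then show ?thesis using that w C(2) by blast
qed

text \<open>\<open>orth_proj\<close> is a definite description, so unique existence has to come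
  first. The representer of the form \<open>x \<bullet> v\<close> on \<open>X\<close> is a
  projection, and two projections differ by a vector orthogonal to itself.\<close>

lemma orth_proj_in:
  fixes X :: "'a::real_inner set"
  assumes "finite_dim_subspace X"
  shows "orth_proj X x \<in> X"
proof -
  have sub: "subspace X" using assms by (simp add: finite_dim_subspace_def)
  have "linear_form_on X (\<lambda>v. x \<bullet> v)"
    by (simp add: linear_form_on_def inner_add_right)
  then obtain p where p: "p \<in> X" "\<And>v. v \<in> X \<Longrightarrow> x \<bullet> v = p \<bullet> v"
    using linear_form_on_representation[OF assms] by blast
  have "\<exists>!p. p \<in> X \<and> (\<forall>y\<in>X. orthogonal (x - p) y)"
  proof (rule ex1I[of _ p])
    show "p \<in> X \<and> (\<forall>y\<in>X. orthogonal (x - p) y)"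
      using p by (simp add: orthogonal_def inner_diff_left)
  next
    fix q assume q: "q \<in> X \<and> (\<forall>y\<in>X. orthogonal (x - q) y)"
    have "p - q \<in> X" using p q sub by (simp add: subspace_diff)
    then have "(x - q) \<bullet> (p - q) = 0" "(x - p) \<bullet> (p - q) = 0"
      using p q by (auto simp: orthogonal_def inner_diff_left)
    then have "(p - q) \<bullet> (p - q) = 0" by (simp add: inner_diff_left)
    then show "q = p" by simp
  qed
  from theI'[OF this] show ?thesis by (simp add: orth_proj_def)
qed

section \<open>Dual norms as norms of representers\<close>

text \<open>Cauchy-Schwarz, with equality at \<open>v = w\<close>. The factor \<open>c\<close>
  covers both \<open>dual_norm\<close> (\<open>c = 1\<close>) and the inner suprema in
  \<open>alpha_const\<close> and \<open>beta_at\<close> (\<open>c = norm m\<close>).\<close>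

lemma SUP_quotient_representation:
  fixes w :: "'a::real_inner"
  assumes "w \<in> W" "\<And>v. v \<in> W \<Longrightarrow> g v = w \<bullet> v" "c > 0"
  shows "(SUP v\<in>W - {0}. ennreal (g v / (c * norm v))) = ennreal (norm w / c)"
proof (rule antisym)
  show "(SUP v\<in>W - {0}. ennreal (g v / (c * norm v))) \<le> ennreal (norm w / c)"
  proof (rule SUP_least)
    fix v assume v: "v \<in> W - {0}"
    have "w \<bullet> v \<le> norm w * norm v" by (rule norm_cauchy_schwarz)
    then have "g v / (c * norm v) \<le> norm w / c"
      using v assms by (simp add: field_simps)
    then show "ennreal (g v / (c * norm v)) \<le> ennreal (norm w / c)"
      by (rule ennreal_leI)
  qed
  show "ennreal (norm w / c) \<le> (SUP v\<in>W - {0}. ennreal (g v / (c * norm v)))"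
  proof (cases "w = 0")
    case False
    then have "norm w / c = g w / (c * norm w)"
      using assms by (simp add: power2_norm_eq_inner[symmetric] power2_eq_square)
    then show ?thesis using False assms(1) by (auto intro: SUP_upper2)
  qed simp
qed

lemma dual_norm_representation:
  fixes w :: "'a::real_inner"
  assumes "w \<in> W" "\<And>v. v \<in> W \<Longrightarrow> g v = w \<bullet> v"
  shows "dual_norm W g = ennreal (norm w)"
  using SUP_quotient_representation[of w W g 1] assms by (simp add: dual_norm_def)

lemma dual_norm_triangle:
  assumes "\<And>v. v \<in> W \<Longrightarrow> g v = g1 v + g2 v"
  shows "dual_norm W g \<le> dual_norm W g1 + dual_norm W g2"
  unfolding dual_norm_def
proof (rule SUP_least)
  fix v assume v: "v \<in> W - {0}"
  have "ennreal (g v / norm v) \<le> ennreal (g1 v / norm v) + ennreal (g2 v / norm v)"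
  proof -
    \<comment> \<open>Since \<open>ennreal\<close> truncates at 0, this is the subadditivity of the
      positive part.\<close>
    have "ennreal (a + b) \<le> ennreal a + ennreal b" for a b
    proof -
      have "ennreal (a + b) \<le> ennreal (max 0 a + max 0 b)" by (intro ennreal_leI) simp
      also have "\<dots> = ennreal a + ennreal b" by (simp add: max_def ennreal_neg)
      finally show ?thesis .
    qed
    then show ?thesis using v assms by (simp add: add_divide_distrib)
  qed
  also have "\<dots> \<le> (SUP v\<in>W - {0}. ennreal (g1 v / norm v)) + (SUP v\<in>W - {0}. ennreal (g2 v / norm v))"
    using v by (intro add_mono SUP_upper)
  finally show "ennreal (g v / norm v) \<le> \<dots>" .
qed

text \<open>The supremum in \<open>dual_norm\<close> is one-sided; for negative \<open>c\<close> it
  is the linearity of \<open>g\<close>, used through the representer, that produces the absolute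
  value.\<close>

lemma dual_norm_scale:
  fixes W :: "'a::real_inner set"
  assumes "finite_dim_subspace W" "linear_form_on W g"
  shows "dual_norm W (\<lambda>v. c * g v) = ennreal \<bar>c\<bar> * dual_norm W g"
proof -
  obtain w where w: "w \<in> W" "\<And>v. v \<in> W \<Longrightarrow> g v = w \<bullet> v"
    using linear_form_on_representation[OF assms] by blast
  have "c *\<^sub>R w \<in> W" using assms w by (simp add: finite_dim_subspace_def subspace_scale)
  then have "dual_norm W (\<lambda>v. c * g v) = ennreal (norm (c *\<^sub>R w))"
    using w by (intro dual_norm_representation) simp_all
  then show ?thesis using dual_norm_representation[OF w] by (simp add: ennreal_mult)
qed

section \<open>The two smallest singular values\<close>

text \<open>First-order optimality condition: a quadratic polynomial that vanishes at 0 and has its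
  minimum there has no linear term.\<close>

lemma linear_coefficient_zero:
  fixes c K :: real
  assumes "\<And>s. 0 \<le> 2 * s * c + s\<^sup>2 * K"
  shows "c = 0"
proof (rule ccontr)
  assume "c \<noteq> 0"
  \<comment> \<open>Any positive \<open>k > K\<close> would do: at \<open>s = - c / k\<close> the
    linear term then outweighs the quadratic one.\<close>
  define k where "k = \<bar>K\<bar> + 1"
  have k: "k > 0" "K < k" by (auto simp: k_def)
  have "2 * (- c / k) * c + (- c / k)\<^sup>2 * K = c\<^sup>2 / k * (K / k - 2)"
    using k by (simp add: power2_eq_square field_simps)
  also have "\<dots> < 0"
    using k \<open>c \<noteq> 0\<close> by (intro mult_pos_neg) (auto simp: field_simps)
  finally show False using assms[of "- c / k"] by simp
qed

text \<open>The plane spanned by \<open>z\<close> and \<open>d\<close> meets the orthogonal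
  complement of every \<open>e\<close> in a nonzero vector, and \<open>d\<close> has the largest
  quotient on that plane, so it bounds every \<open>beta_at\<close>. Finiteness depends on the
  existence of \<open>d\<close>: if \<open>X\<close> is a line, the infimum at \<open>e = z\<close>
  is over the empty set and \<open>beta_const\<close> is infinite.\<close>

lemma beta_const_le_dual_norm:
  fixes X :: "'a::real_inner set" and W :: "'b::real_inner set"
  assumes X: "subspace X" and W: "finite_dim_subspace W"
    and A: "bounded_operator_on X W A"
    and z: "z \<in> X" "norm z = 1" "dual_norm W (A z) = alpha_const X W A"
    and d: "d \<in> X" "orthogonal d z" "d \<noteq> 0"
  shows "beta_const X W A * ennreal (norm d) \<le> dual_norm W (A d)" "beta_const X W A < \<infinity>"
proof -
  have lin: "linear_form_on W (A m)" if "m \<in> X" for m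
    using A that by (simp add: bounded_operator_on_def)
  obtain wz where wz: "wz \<in> W" "\<And>v. v \<in> W \<Longrightarrow> A z v = wz \<bullet> v"
    using linear_form_on_representation[OF W lin[OF z(1)]] by blast
  obtain wd where wd: "wd \<in> W" "\<And>v. v \<in> W \<Longrightarrow> A d v = wd \<bullet> v"
    using linear_form_on_representation[OF W lin[OF d(1)]] by blast
  have W': "subspace W" using W by (simp add: finite_dim_subspace_def)
  have mem: "a *\<^sub>R z + b *\<^sub>R d \<in> X" "a *\<^sub>R wz + b *\<^sub>R wd \<in> W" for a b
    using X W' z d wz wd by (auto intro: subspace_add subspace_scale)
  have zd: "z \<bullet> d = 0" "d \<bullet> z = 0" "z \<bullet> z = 1"
    using d z by (auto simp: orthogonal_def inner_commute norm_eq_1)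
  have norm_comb: "(norm (a *\<^sub>R z + b *\<^sub>R d))\<^sup>2 = a\<^sup>2 + b\<^sup>2 * (norm d)\<^sup>2" for a b
    by (simp add: power2_norm_eq_inner inner_add_left inner_add_right zd)
       (simp add: power2_eq_square)
  have rep: "A (a *\<^sub>R z + b *\<^sub>R d) v = (a *\<^sub>R wz + b *\<^sub>R wd) \<bullet> v" if "v \<in> W" for a b v
  proof -
    have "A (a *\<^sub>R z + b *\<^sub>R d) v = A (a *\<^sub>R z) v + A (b *\<^sub>R d) v"
      using A that z d X by (simp add: bounded_operator_on_def subspace_scale)
    then show ?thesis
      using A that z d wz wd by (simp add: bounded_operator_on_def inner_add_left)
  qed
  have sup_eq: "(SUP v\<in>W - {0}. ennreal (A (a *\<^sub>R z + b *\<^sub>R d) v / (norm (a *\<^sub>R z + b *\<^sub>R d) * norm v)))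
      = ennreal (norm (a *\<^sub>R wz + b *\<^sub>R wd) / norm (a *\<^sub>R z + b *\<^sub>R d))"
    if "a *\<^sub>R z + b *\<^sub>R d \<noteq> 0" for a b
    using that by (intro SUP_quotient_representation mem rep) simp_all
  have min: "norm wz * norm (a *\<^sub>R z + b *\<^sub>R d) \<le> norm (a *\<^sub>R wz + b *\<^sub>R wd)"
    if nz: "a *\<^sub>R z + b *\<^sub>R d \<noteq> 0" for a b
  proof -
    have "ennreal (norm wz) = alpha_const X W A"
      using dual_norm_representation[of wz W "A z"] wz z by simp
    also have "\<dots> \<le> ennreal (norm (a *\<^sub>R wz + b *\<^sub>R wd) / norm (a *\<^sub>R z + b *\<^sub>R d))"
      unfolding alpha_const_def sup_eq[OF nz, symmetric]
      using mem nz by (intro INF_lower) simp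
    finally show ?thesis using nz by (simp add: field_simps)
  qed
  \<comment> \<open>The minimality of \<open>z\<close> is tested against \<open>z + s d\<close> and
    squared. The terms of order zero in \<open>s\<close> cancel, and the linear coefficient is the
    inner product of the two images.\<close>
  have "0 \<le> 2 * s * (wz \<bullet> wd) + s\<^sup>2 * ((norm wd)\<^sup>2 - (norm wz)\<^sup>2 * (norm d)\<^sup>2)" for s
  proof -
    have nz: "1 *\<^sub>R z + s *\<^sub>R d \<noteq> 0"
      using norm_comb[of 1 s] by (metis add_pos_nonneg mult_nonneg_nonneg norm_zero one_power2
        less_irrefl power_zero_numeral zero_le_power2 zero_less_one)
    have "(norm wz * norm (1 *\<^sub>R z + s *\<^sub>R d))\<^sup>2 \<le> (norm (1 *\<^sub>R wz + s *\<^sub>R wd))\<^sup>2"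
      by (intro power_mono min nz) simp
    then have "(norm wz)\<^sup>2 * (1 + s\<^sup>2 * (norm d)\<^sup>2) \<le> (norm (wz + s *\<^sub>R wd))\<^sup>2"
      unfolding power_mult_distrib norm_comb by simp
    moreover have "(norm (wz + s *\<^sub>R wd))\<^sup>2 = (norm wz)\<^sup>2 + 2 * s * (wz \<bullet> wd) + s\<^sup>2 * (norm wd)\<^sup>2"
      unfolding power2_norm_eq_inner
      by (simp add: inner_add_left inner_add_right inner_commute[of wd wz] power2_eq_square
          algebra_simps)
    ultimately show ?thesis by (simp add: algebra_simps)
  qed
  then have orth: "wz \<bullet> wd = 0" by (rule linear_coefficient_zero)
  have "norm wz * norm d \<le> norm wd" using min[of 0 1] d by simp
  then have wz_le: "(norm wz)\<^sup>2 * (norm d)\<^sup>2 \<le> (norm wd)\<^sup>2"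
    by (metis power_mono power_mult_distrib mult_nonneg_nonneg norm_ge_zero)
  have "beta_at X W A e \<le> ennreal (norm wd / norm d)" for e
  proof -
    \<comment> \<open>Orthogonality to \<open>e\<close> is one linear equation in two unknowns, so a
      nontrivial combination satisfies it.\<close>
    obtain a b where ab: "a \<noteq> 0 \<or> b \<noteq> 0" "a * (z \<bullet> e) + b * (d \<bullet> e) = 0"
    proof (cases "z \<bullet> e = 0 \<and> d \<bullet> e = 0")
      case True
      then show ?thesis using that[of 1 0] by simp
    next
      case False
      then show ?thesis using that[of "d \<bullet> e" "- (z \<bullet> e)"] by auto
    qed
    define m where "m = a *\<^sub>R z + b *\<^sub>R d"
    have "(norm m)\<^sup>2 > 0"
      unfolding m_def norm_comb using ab(1) d(3)
      by (auto intro: add_pos_nonneg add_nonneg_pos)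
    then have nz: "m \<noteq> 0" by auto
    have "(norm (a *\<^sub>R wz + b *\<^sub>R wd))\<^sup>2 = a\<^sup>2 * (norm wz)\<^sup>2 + b\<^sup>2 * (norm wd)\<^sup>2"
      using orth
      by (simp add: power2_norm_eq_inner inner_add_left inner_add_right inner_commute[of wd wz])
        (simp add: power2_eq_square)
    \<comment> \<open>As the images are orthogonal, the squared quotient at \<open>m\<close> is a
      weighted mean of those at \<open>z\<close> and \<open>d\<close>, hence at most the larger one,
      which is that at \<open>d\<close>.\<close>
    then have "(norm (a *\<^sub>R wz + b *\<^sub>R wd) * norm d)\<^sup>2
        = a\<^sup>2 * ((norm wz)\<^sup>2 * (norm d)\<^sup>2) + b\<^sup>2 * (norm d)\<^sup>2 * (norm wd)\<^sup>2"
      by (simp add: power_mult_distrib algebra_simps)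
    also have "\<dots> \<le> a\<^sup>2 * (norm wd)\<^sup>2 + b\<^sup>2 * (norm d)\<^sup>2 * (norm wd)\<^sup>2"
      using wz_le by (intro add_mono mult_left_mono) auto
    also have "\<dots> = (norm wd * norm m)\<^sup>2"
      unfolding m_def power_mult_distrib norm_comb by (simp add: algebra_simps)
    finally have "norm (a *\<^sub>R wz + b *\<^sub>R wd) * norm d \<le> norm wd * norm m"
      by (rule power2_le_imp_le) simp
    then have le: "norm (a *\<^sub>R wz + b *\<^sub>R wd) / norm m \<le> norm wd / norm d"
      using nz d(3) by (simp add: field_simps)
    have "beta_at X W A e \<le> (SUP v\<in>W - {0}. ennreal (A m v / (norm m * norm v)))"
      unfolding beta_at_def using ab(2) nz mem
      by (intro INF_lower) (simp add: m_def orthogonal_def inner_add_left)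
    also have "\<dots> \<le> ennreal (norm wd / norm d)"
      using sup_eq[of a b] nz le by (simp add: m_def ennreal_leI)
    finally show ?thesis .
  qed
  then have le: "beta_const X W A \<le> ennreal (norm wd / norm d)"
    unfolding beta_const_def by (intro SUP_least)
  then show "beta_const X W A < \<infinity>" by (simp add: order.strict_trans1)
  have "beta_const X W A * ennreal (norm d) \<le> ennreal (norm wd / norm d) * ennreal (norm d)"
    using le by (rule mult_right_mono) simp
  also have "\<dots> = ennreal (norm wd)" using d(3) by (simp flip: ennreal_mult)
  finally show "beta_const X W A * ennreal (norm d) \<le> dual_norm W (A d)"
    using dual_norm_representation[of wd W "A d"] wd by simp
qed

section \<open>Consistency terms, and division in the extended half-line\<close>

lemma quotient_le_rho_const:
  fixes T :: "'a::real_normed_vector \<Rightarrow>\<^sub>L ('b::real_normed_vector \<Rightarrow>\<^sub>L real)"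
  assumes "v \<noteq> 0"
  shows "ennreal (T m v / norm v)
    \<le> rho_const UNIV UNIV (\<lambda>m. blinfun_apply (T m)) * ennreal (norm m)"
proof (cases "m = 0")
  case False
  have "ennreal (T m v / norm v) = ennreal (T m v / (norm m * norm v)) * ennreal (norm m)"
    using False by (subst ennreal_mult''[symmetric]) simp_all
  also have "ennreal (T m v / (norm m * norm v)) \<le> rho_const UNIV UNIV (\<lambda>m. blinfun_apply (T m))"
    unfolding rho_const_def using False assms by (auto intro!: SUP_upper2[of m] SUP_upper2[of v])
  finally show ?thesis by (simp add: mult_right_mono)
qed simp

lemma dual_norm_le_rho_const:
  fixes T :: "'a::real_normed_vector \<Rightarrow>\<^sub>L ('b::real_normed_vector \<Rightarrow>\<^sub>L real)"
  shows "dual_norm W (T m) \<le> rho_const UNIV UNIV (\<lambda>m. blinfun_apply (T m)) * ennreal (norm m)"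
  unfolding dual_norm_def by (rule SUP_least) (simp add: quotient_le_rho_const)

text \<open>At the exact solution this bounds \<open>norm f\<close>, which turns the relative error
  \<open>eps_rhs\<close> into a multiple of \<open>rho_const\<close>. The bound on
  \<open>T m v\<close> is one-sided; applying it to \<open>- v\<close> as well gives the absolute
  value.\<close>

lemma norm_le_rho_const:
  fixes T :: "'a::real_normed_vector \<Rightarrow>\<^sub>L ('b::real_normed_vector \<Rightarrow>\<^sub>L real)"
  shows "ennreal (norm (T m)) \<le> rho_const UNIV UNIV (\<lambda>m. blinfun_apply (T m)) * ennreal (norm m)"
    (is "_ \<le> ?b")
proof (cases ?b)
  case (real b)
  have le: "T m v \<le> b * norm v" for v
  proof (cases "v = 0")
    case False
    then have "ennreal (T m v / norm v) \<le> ennreal b" using quotient_le_rho_const real by metis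
    then show ?thesis using False real(1) by (simp add: field_simps)
  qed simp
  have "norm (T m v) \<le> b * norm v" for v
    using le[of v] le[of "- v"] by (simp add: blinfun.minus_right)
  then have "norm (T m) \<le> b" using real(1) by (intro norm_blinfun_bound)
  then show ?thesis using real by (simp add: ennreal_leI)
qed simp

lemma dual_norm_le_eps_op:
  fixes T :: "'a::real_normed_vector \<Rightarrow>\<^sub>L ('b::real_normed_vector \<Rightarrow>\<^sub>L real)"
  assumes "m \<in> X" "m \<noteq> 0" "nE m > 0"
  shows "dual_norm W (\<lambda>v. A m v - T m v) \<le> eps_op nE X W A T * ennreal (nE m)"
  unfolding dual_norm_def
proof (rule SUP_least)
  fix v assume v: "v \<in> W - {0}"
  have "ennreal ((A m v - T m v) / norm v)
      = ennreal ((A m v - T m v) / (nE m * norm v)) * ennreal (nE m)"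
    using assms by (subst ennreal_mult''[symmetric]) simp_all
  also have "ennreal ((A m v - T m v) / (nE m * norm v)) \<le> eps_op nE X W A T"
    unfolding eps_op_def using assms v by (auto intro!: SUP_upper2[of m] SUP_upper2[of v])
  finally show "ennreal ((A m v - T m v) / norm v) \<le> eps_op nE X W A T * ennreal (nE m)"
    by (simp add: mult_right_mono)
qed

lemma dual_norm_eq_eps_rhs:
  fixes f :: "'a::real_normed_vector \<Rightarrow>\<^sub>L real"
  assumes "f \<noteq> 0"
  shows "dual_norm W (\<lambda>v. g v - f v) = ennreal (norm f) * eps_rhs W g f"
proof -
  have "ennreal (norm f) * ennreal (1 / norm f) = 1"
    using assms by (simp flip: ennreal_mult)
  then show ?thesis by (simp add: eps_rhs_def dual_norm_def flip: mult.assoc)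
qed

lemma ennreal_divide_le_scaled_inverse:
  fixes b c S a :: ennreal
  assumes "b * ennreal x \<le> ennreal y * (4 * S + 2 * a)" "0 < b" "b < \<infinity>" "0 \<le> x" "0 < y"
  shows "ennreal (x / y) \<le> 4 / b * (S + a / 2)"
proof -
  have two: "4 * (a / 2) = 2 * a"
  proof -
    have "4 * (a / 2) = 2 * (2 * a / 2)" by (simp add: ennreal_times_divide flip: mult.assoc)
    also have "2 * a / 2 = a"
      by (simp add: mult.commute[of 2] ennreal_mult_divide_eq)
    finally show ?thesis .
  qed
  have inv: "inverse b * b = 1" "inverse (ennreal y) * ennreal y = 1"
    using assms by (simp_all add: mult.commute ennreal_divide_self flip: divide_ennreal_def)
  have "ennreal (x / y) = inverse (ennreal y) * ennreal x"
    using assms by (simp add: divide_ennreal[symmetric] divide_ennreal_def mult.commute)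
  also have "\<dots> = inverse b * inverse (ennreal y) * (b * ennreal x)"
    using inv by (metis mult.assoc mult.commute mult.right_neutral)
  also have "\<dots> \<le> inverse b * inverse (ennreal y) * (ennreal y * (4 * S + 2 * a))"
    by (intro mult_left_mono assms(1)) simp
  also have "\<dots> = inverse b * (4 * S + 2 * a)"
    using inv by (metis mult.assoc mult.right_neutral)
  also have "\<dots> = 4 / b * (S + a / 2)"
    unfolding divide_ennreal_def[of 4] two[symmetric] distrib_left[symmetric] by (simp only: ac_simps)
  finally show ?thesis .
qed

section \<open>Error estimate for the solution corrected along \<open>z\<close>\<close>

theorem theorem4:
  fixes E :: "'m::{real_inner,complete_space} set"
    and nE :: "'m \<Rightarrow> real"
    and Mh :: "real \<Rightarrow> 'm set"
    and Vh :: "real \<Rightarrow> 'v::{real_inner,complete_space} set"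
    and T :: "'m \<Rightarrow>\<^sub>L ('v \<Rightarrow>\<^sub>L real)"
    and f :: "'v \<Rightarrow>\<^sub>L real"
    and Th :: "real \<Rightarrow> 'm \<Rightarrow> 'v \<Rightarrow> real"
    and fh :: "real \<Rightarrow> 'v \<Rightarrow> real"
    and \<mu> z \<mu>h :: 'm
    and r h :: real
  assumes E_banach: "banach_space_on E nE"
    and E_dense: "closure E = UNIV"
    and Mh_findim: "\<And>k. k > 0 \<Longrightarrow> finite_dim_subspace (Mh k)"
    and Vh_findim: "\<And>k. k > 0 \<Longrightarrow> finite_dim_subspace (Vh k)"
    and Mh_approaches: "approaches_space Mh"
    and Vh_approaches: "approaches_space Vh"
    and Mh_subset_E: "\<And>k. k > 0 \<Longrightarrow> Mh k \<subseteq> E"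
    and proj_E: "\<And>k m. k > 0 \<Longrightarrow> m \<in> E \<Longrightarrow> nE (orth_proj (Mh k) m) \<le> nE m"
    and Th_operator: "\<And>k. k > 0 \<Longrightarrow> bounded_operator_on (Mh k) (Vh k) (Th k)"
    and fh_form: "\<And>k. k > 0 \<Longrightarrow> linear_form_on (Vh k) (fh k)"
    and f_nonzero: "f \<noteq> 0"
    and \<mu>_in_E: "\<mu> \<in> E"
    and \<mu>_solution: "T \<mu> = f"
    and h_pos: "h > 0"
    and int_small: "eps_int (Mh h) \<mu> \<le> 1 / 2"
    and r_pos: "r > 0"
    and r_bound: "nE \<mu> \<le> r * norm \<mu>"
    and z_in: "z \<in> Mh h"
    and z_norm: "norm z = 1"
    and z_min: "dual_norm (Vh h) (Th h z) = alpha_const (Mh h) (Vh h) (Th h)"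
    and \<mu>h_argmin: "is_arg_min (\<lambda>m. dual_norm (Vh h) (\<lambda>v. Th h m v - fh h v))
                       (\<lambda>m. m \<in> Mh h \<and> orthogonal m z) \<mu>h"
    and beta_pos: "beta_const (Mh h) (Vh h) (Th h) > 0"
  shows "\<exists>t::real.
    ennreal (norm (t *\<^sub>R z + \<mu>h - orth_proj (Mh h) \<mu>) / norm (orth_proj (Mh h) \<mu>))
      \<le> 4 / beta_const (Mh h) (Vh h) (Th h) *
          (ennreal r * eps_op nE (Mh h) (Vh h) (Th h) T
           + rho_const UNIV UNIV (\<lambda>m. blinfun_apply (T m))
               * (eps_rhs (Vh h) (fh h) f + ennreal (eps_int (Mh h) \<mu>))
           + alpha_const (Mh h) (Vh h) (Th h) / 2)"
proof -
  define X where "X = Mh h"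
  define W where "W = Vh h"
  define A where "A = Th h"
  define p where "p = orth_proj X \<mu>"
  \<comment> \<open>The witness for \<open>t\<close>: with the component of \<open>p\<close> along
    \<open>z\<close>, the error \<open>s z + \<mu>h - p\<close> is exactly \<open>d\<close>, which
    is orthogonal to \<open>z\<close>.\<close>
  define s where "s = p \<bullet> z"
  define q where "q = p - s *\<^sub>R z"
  define d where "d = \<mu>h - q"
  define \<rho> where "\<rho> = rho_const UNIV UNIV (\<lambda>m. blinfun_apply (T m))"
  define op where "op = eps_op nE X W A T"
  define rhs where "rhs = eps_rhs W (fh h) f"
  define \<alpha> where "\<alpha> = alpha_const X W A"
  define \<beta> where "\<beta> = beta_const X W A"
  define S where "S = ennreal r * op + \<rho> * (rhs + ennreal (eps_int X \<mu>))"
  have fdX: "finite_dim_subspace X" and fdW: "finite_dim_subspace W"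
    and A: "bounded_operator_on X W A"
    using Mh_findim Vh_findim Th_operator h_pos by (auto simp: X_def W_def A_def)
  have X: "subspace X" using fdX by (simp add: finite_dim_subspace_def)
  have p: "p \<in> X" using orth_proj_in[OF fdX] by (simp add: p_def)
  have zX: "z \<in> X" using z_in by (simp add: X_def)
  have lin: "linear_form_on W (A m)" if "m \<in> X" for m
    using A that by (simp add: bounded_operator_on_def)
  have A_comb: "A (m - c *\<^sub>R n) v = A m v - c * A n v" if "m \<in> X" "n \<in> X" "v \<in> W" for m n c v
  proof -
    have "A (m + (- c) *\<^sub>R n) v = A m v + A ((- c) *\<^sub>R n) v"
      using A X that unfolding bounded_operator_on_def by (blast intro: subspace_scale)
    also have "A ((- c) *\<^sub>R n) v = (- c) * A n v"
      using A that unfolding bounded_operator_on_def by blast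
    finally show ?thesis by simp
  qed
  have "\<mu> \<noteq> 0" using \<mu>_solution f_nonzero by auto
  then have \<mu>_pos: "norm \<mu> > 0" by simp
  have int_eq: "norm (p - \<mu>) = eps_int X \<mu> * norm \<mu>"
    using \<mu>_pos by (simp add: eps_int_def p_def)
  have int_nonneg: "0 \<le> eps_int X \<mu>" by (simp add: eps_int_def)
  have "norm (p - \<mu>) \<le> norm \<mu> / 2"
    using int_small \<mu>_pos mult_right_mono[of "eps_int X \<mu>" "1/2" "norm \<mu>"]
    by (simp add: int_eq X_def)
  \<comment> \<open>The threshold 1/2 is used here: it makes \<open>p\<close> nonzero and lets
    \<open>norm p\<close> replace the norm of the solution at the cost of a factor 2.\<close>
  then have \<mu>_le: "norm \<mu> \<le> 2 * norm p"
    using norm_triangle_ineq2[of \<mu> p] by (simp add: norm_minus_commute)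
  then have p_pos: "norm p > 0" using \<mu>_pos by linarith
  have q: "q \<in> X" "orthogonal q z"
    using p zX X z_norm
    by (auto simp: q_def s_def orthogonal_def inner_diff_left norm_eq_1 subspace_diff subspace_scale)
  have \<mu>h: "\<mu>h \<in> X" "orthogonal \<mu>h z"
    using \<mu>h_argmin by (auto simp: is_arg_min_def X_def)
  have d: "d \<in> X" "orthogonal d z"
    using q \<mu>h X by (auto simp: d_def subspace_diff orthogonal_def inner_diff_left)
  have diff: "s *\<^sub>R z + \<mu>h - p = d" by (simp add: d_def q_def)
  have "ennreal (norm d / norm p) \<le> 4 / \<beta> * (S + \<alpha> / 2)"
  \<comment> \<open>For \<open>d = 0\<close> the left side is 0; only a nonzero \<open>d\<close>
    ensures that \<open>\<beta>\<close> is finite.\<close>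
  proof (cases "d = 0")
    case False
    have beta: "\<beta> * ennreal (norm d) \<le> dual_norm W (A d)" "\<beta> < \<infinity>"
      using beta_const_le_dual_norm[OF X fdW A zX z_norm _ d False] z_min
      by (simp_all add: \<beta>_def X_def W_def A_def)
    define Y where "Y = dual_norm W (\<lambda>v. A q v - fh h v)"
    have lin_q: "linear_form_on W (\<lambda>v. A q v - fh h v)"
      using lin[OF q(1)] fh_form[OF h_pos]
      by (simp add: linear_form_on_def W_def algebra_simps)
    have "A d v = (A \<mu>h v - fh h v) + (- 1) * (A q v - fh h v)" if "v \<in> W" for v
      using A_comb[OF \<mu>h(1) q(1) that, of 1] by (simp add: d_def)
    then have "dual_norm W (A d) \<le> dual_norm W (\<lambda>v. A \<mu>h v - fh h v)
        + dual_norm W (\<lambda>v. (- 1) * (A q v - fh h v))"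
      by (rule dual_norm_triangle)
    also have "dual_norm W (\<lambda>v. (- 1) * (A q v - fh h v)) = Y"
      using dual_norm_scale[OF fdW lin_q, of "-1"] by (simp add: Y_def)
    \<comment> \<open>\<open>q\<close> lies in \<open>X\<close> and is orthogonal to
      \<open>z\<close>, so it is an admissible competitor in the minimization.\<close>
    also have "dual_norm W (\<lambda>v. A \<mu>h v - fh h v) \<le> Y"
      using \<mu>h_argmin q by (auto simp: is_arg_min_def X_def W_def A_def Y_def not_less)
    finally have dY: "dual_norm W (A d) \<le> 2 * Y" by (simp add: mult_2 add_right_mono)
    have "A q v - fh h v = (A p v - fh h v) + (- s) * A z v" if "v \<in> W" for v
      using A_comb[OF p zX that, of s] by (simp add: q_def)
    then have "Y \<le> dual_norm W (\<lambda>v. A p v - fh h v) + dual_norm W (\<lambda>v. (- s) * A z v)"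
      unfolding Y_def by (rule dual_norm_triangle)
    also have "dual_norm W (\<lambda>v. (- s) * A z v) = ennreal \<bar>s\<bar> * \<alpha>"
      using dual_norm_scale[OF fdW lin[OF zX], of "- s"] z_min
      by (simp add: \<alpha>_def X_def W_def A_def)
    also have "\<dots> \<le> ennreal (norm p) * \<alpha>"
      using Cauchy_Schwarz_ineq2[of p z] z_norm
      by (intro mult_right_mono ennreal_leI) (simp_all add: s_def)
    finally have Y_le: "Y \<le> dual_norm W (\<lambda>v. A p v - fh h v) + ennreal (norm p) * \<alpha>"
      by (simp add: add_left_mono)
    \<comment> \<open>The residual at \<open>p\<close> splits into \<open>(A - T) p\<close>,
      \<open>T (p - \<mu>)\<close> and \<open>f - fh h\<close>: the operator, interpolation and
      right-hand side errors.\<close>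
    have "dual_norm W (\<lambda>v. A p v - fh h v)
        \<le> dual_norm W (\<lambda>v. A p v - T p v) + dual_norm W (\<lambda>v. T p v - fh h v)"
      by (rule dual_norm_triangle) simp
    also have "dual_norm W (\<lambda>v. T p v - fh h v)
        \<le> dual_norm W (T (p - \<mu>)) + dual_norm W (\<lambda>v. (- 1) * (fh h v - f v))"
      by (rule dual_norm_triangle) (simp add: blinfun.diff_right blinfun.diff_left \<mu>_solution)
    also have "dual_norm W (\<lambda>v. (- 1) * (fh h v - f v)) = ennreal (norm f) * rhs"
    proof -
      have "linear_form_on W (\<lambda>v. fh h v - f v)"
        using fh_form[OF h_pos]
        by (simp add: linear_form_on_def W_def algebra_simps blinfun.add_right blinfun.scaleR_right)
      from dual_norm_scale[OF fdW this, of "-1"] show ?thesis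
        by (simp add: dual_norm_eq_eps_rhs[OF f_nonzero] rhs_def)
    qed
    also have "ennreal (norm f) * rhs \<le> \<rho> * ennreal (norm \<mu>) * rhs"
      using norm_le_rho_const[of T \<mu>] by (intro mult_right_mono) (simp_all add: \<mu>_solution \<rho>_def)
    also have "dual_norm W (T (p - \<mu>)) \<le> \<rho> * ennreal (norm (p - \<mu>))"
      unfolding \<rho>_def by (rule dual_norm_le_rho_const)
    also have "dual_norm W (\<lambda>v. A p v - T p v) \<le> op * ennreal (r * norm \<mu>)"
    proof -
      have "p \<in> E" using p Mh_subset_E[OF h_pos] by (auto simp: X_def)
      then have "nE p > 0"
        using E_banach p_pos by (force simp: banach_space_on_def order.strict_iff_order)
      then have "dual_norm W (\<lambda>v. A p v - T p v) \<le> op * ennreal (nE p)"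
        unfolding op_def using p p_pos by (intro dual_norm_le_eps_op) auto
      \<comment> \<open>Stability of the projection in the \<open>E\<close>-norm, followed by the
        bound defining \<open>r\<close>.\<close>
      also have "\<dots> \<le> op * ennreal (r * norm \<mu>)"
        using proj_E[OF h_pos \<mu>_in_E] r_bound
        by (intro mult_left_mono ennreal_leI) (auto simp: p_def X_def)
      finally show ?thesis .
    qed
    finally have "dual_norm W (\<lambda>v. A p v - fh h v) \<le> op * ennreal (r * norm \<mu>)
        + (\<rho> * ennreal (norm (p - \<mu>)) + \<rho> * ennreal (norm \<mu>) * rhs)"
      by (simp add: add_mono add_left_mono add_right_mono)
    also have "\<dots> = ennreal (norm \<mu>) * S"
      using r_pos int_nonneg by (simp add: int_eq S_def ennreal_mult algebra_simps)
    also have "\<dots> \<le> ennreal (2 * norm p) * S"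
      using \<mu>_le by (intro mult_right_mono ennreal_leI) simp_all
    finally have "Y \<le> ennreal (2 * norm p) * S + ennreal (norm p) * \<alpha>"
      using Y_le by (meson add_right_mono order_trans)
    \<comment> \<open>The final 4 is the 2 from comparing residuals times the 2 from
      \<open>\<mu>_le\<close>. The \<alpha> term is already scaled by \<open>norm p\<close> and gets
      only the first factor, hence \<alpha>/2 in the bracket.\<close>
    then have "2 * Y \<le> 2 * (ennreal (2 * norm p) * S + ennreal (norm p) * \<alpha>)"
      by (intro mult_left_mono) simp_all
    also have "\<dots> = ennreal (norm p) * (4 * S + 2 * \<alpha>)"
      by (simp add: ennreal_mult algebra_simps)
    finally have "\<beta> * ennreal (norm d) \<le> ennreal (norm p) * (4 * S + 2 * \<alpha>)"
      using beta(1) dY by (meson order_trans)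
    then show ?thesis
      using beta(2) beta_pos p_pos
      by (intro ennreal_divide_le_scaled_inverse) (simp_all add: \<beta>_def X_def W_def A_def)
  qed simp
  then show ?thesis
    unfolding diff[symmetric]
    by (intro exI[of _ s])
      (simp add: S_def \<alpha>_def \<beta>_def \<rho>_def op_def rhs_def p_def X_def W_def A_def)
qed

end
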